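(* Let $b$ be a graph over $(X,m)$ and let $d$ be an intrinsic pseudo metric on $X$ with finite distance balls. Assume that the graph with $d$ is globally local with respect to a monotone increasing function $f:(0,\infty)\to(0,\infty)$ satisfying $$\int_1^\infty\frac{r}{f(r)}\,dr=\infty.$$ Let $0<T\le\infty$ and let $u:(0,T)\times X\to\mathbb{R}$ be a solution to the heat equation with initial value $0$. If $$\int_0^T\sum_{x\in B_r}|u_t(x)|^2m(x)\,dt\le e^{f(r)}$$ for every $r>0$, then $u_t=0$ for all $t\in(0,T)$.
   Context: $X$ is a countable discrete set with a fixed reference vertex $o\in X$, and $m:X\to(0,\infty)$ is extended to a measure on all subsets of $X$ by additivity. A graph over $(X,m)$ is a symmetric map $b:X\times X\to[0,\infty)$ with $b(x,x)=0$ and $\sum_{y\in X}b(x,y)<\infty$ for all $x\in X$. Write $x\sim y$ if $b(x,y)>0$. A pseudo metric $d$ on $X$ is intrinsic if $\sum_{y\in X}b(x,y)d(x,y)^2\le m(x)$ for all $x\in X$. Distance balls: $B_r=\{y\in X\mid d(o,y)\le r\}$, $r\ge 0$; "finite distance balls" means all $B_r$ are finite sets. Jump size: $s=\sup\{d(x,y)\mid x,y\in X,\ x\sim y\}$, and the jump size outside of $B_r$ is $s_r=\sup\{d(x,y)\mid x,y\in X,\ x\sim y,\ \min(d(x,o),d(y,o))\ge r\}$, $r\ge 0$ (supremum of the empty set being $0$); thus $s=s_0$. The graph with pseudo metric $d$ is globally local with respect to a monotone increasing function $f:(0,\infty)\to(0,\infty)$ if $s<\infty$ and there is a constant $A>1$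 with $\limsup_{r\to\infty}\frac{s_rf(Ar)}{r}<\infty$. Let $\mathcal{F}(X)=\{g:X\to\mathbb{R}\mid\sum_{y\in X}b(x,y)|g(y)|<\infty\text{ for all }x\in X\}$ and $\mathcal{L}g(x)=\frac{1}{m(x)}\sum_{y\in X}b(x,y)(g(x)-g(y))$ for $g\in\mathcal{F}(X)$. A function $u:(0,T)\times X\to\mathbb{R}$, with $u_t=u(t,\cdot)$, is a solution to the heat equation with initial value $u_0:X\to\mathbb{R}$ if $u_t\in\mathcal{F}(X)$ for every $t\in(0,T)$; for every $x\in X$ the function $t\mapsto u_t(x)$ is continuously differentiable on $(0,T)$ with $u_t(x)\to u_0(x)$ as $t\to0+$; and $\partial_tu=-\mathcal{L}u$ on $(0,T)\times X$. *)

theory Defs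
  imports "HOL-Analysis.Analysis"
begin

definition weighted_graph :: "('a \<Rightarrow> real) \<Rightarrow> ('a \<Rightarrow> 'a \<Rightarrow> real) \<Rightarrow> bool" where
  "weighted_graph m b \<longleftrightarrow>
     (\<forall>x. m x > 0) \<and>
     (\<forall>x y. b x y \<ge> 0) \<and> (\<forall>x y. b x y = b y x) \<and> (\<forall>x. b x x = 0) \<and>
     (\<forall>x. (\<lambda>y. b x y) summable_on UNIV)"

definition pseudo_metric :: "('a \<Rightarrow> 'a \<Rightarrow> real) \<Rightarrow> bool" where
  "pseudo_metric d \<longleftrightarrow>
     (\<forall>x y. d x y \<ge> 0) \<and> (\<forall>x. d x x = 0) \<and> (\<forall>x y. d x y = d y x) \<and>
     (\<forall>x y z. d x z \<le> d x y + d y z)"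

text \<open>Since \<open>infsum\<close> is 0 on families that are not summable, finiteness of the
  sum has to be required explicitly.\<close>

definition intrinsic :: "('a \<Rightarrow> real) \<Rightarrow> ('a \<Rightarrow> 'a \<Rightarrow> real) \<Rightarrow> ('a \<Rightarrow> 'a \<Rightarrow> real) \<Rightarrow> bool" where
  "intrinsic m b d \<longleftrightarrow> pseudo_metric d \<and>
     (\<forall>x. (\<lambda>y. b x y * (d x y)\<^sup>2) summable_on UNIV \<and>
          (\<Sum>\<^sub>\<infinity>y. b x y * (d x y)\<^sup>2) \<le> m x)"

definition dist_ball :: "('a \<Rightarrow> 'a \<Rightarrow> real) \<Rightarrow> 'a \<Rightarrow> real \<Rightarrow> 'a set" where
  "dist_ball d p r = {y. d p y \<le> r}"

text \<open>Jump sizes may be infinite; in \<open>ennreal\<close> the supremum of the empty set is 0.\<close>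

definition jump_size :: "('a \<Rightarrow> 'a \<Rightarrow> real) \<Rightarrow> ('a \<Rightarrow> 'a \<Rightarrow> real) \<Rightarrow> ennreal" where
  "jump_size b d = Sup {ennreal (d x y) | x y. b x y > 0}"

definition jump_size_outside ::
  "('a \<Rightarrow> 'a \<Rightarrow> real) \<Rightarrow> ('a \<Rightarrow> 'a \<Rightarrow> real) \<Rightarrow> 'a \<Rightarrow> real \<Rightarrow> ennreal" where
  "jump_size_outside b d p r =
     Sup {ennreal (d x y) | x y. b x y > 0 \<and> min (d x p) (d y p) \<ge> r}"

definition globally_local ::
  "('a \<Rightarrow> 'a \<Rightarrow> real) \<Rightarrow> ('a \<Rightarrow> 'a \<Rightarrow> real) \<Rightarrow> 'a \<Rightarrow> (real \<Rightarrow> real) \<Rightarrow> bool" where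
  "globally_local b d p f \<longleftrightarrow> jump_size b d < \<infinity> \<and>
     (\<exists>A>1. Limsup at_top
        (\<lambda>r::real. jump_size_outside b d p r * ennreal (f (A * r)) / ennreal r) < \<infinity>)"

definition laplacian_domain :: "('a \<Rightarrow> 'a \<Rightarrow> real) \<Rightarrow> ('a \<Rightarrow> real) set" where
  "laplacian_domain b = {g. \<forall>x. (\<lambda>y. b x y * \<bar>g y\<bar>) summable_on UNIV}"

definition laplacian ::
  "('a \<Rightarrow> real) \<Rightarrow> ('a \<Rightarrow> 'a \<Rightarrow> real) \<Rightarrow> ('a \<Rightarrow> real) \<Rightarrow> 'a \<Rightarrow> real" where
  "laplacian m b g x = 1 / m x * (\<Sum>\<^sub>\<infinity>y. b x y * (g x - g y))"

definition time_interval :: "ereal \<Rightarrow> real set" where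
  "time_interval T = {t. 0 < t \<and> ereal t < T}"

text \<open>Only the values of \<open>u\<close> on \<open>time_interval T\<close> matter.\<close>

definition heat_solution ::
  "('a \<Rightarrow> real) \<Rightarrow> ('a \<Rightarrow> 'a \<Rightarrow> real) \<Rightarrow> ereal \<Rightarrow> ('a \<Rightarrow> real) \<Rightarrow> (real \<Rightarrow> 'a \<Rightarrow> real) \<Rightarrow> bool" where
  "heat_solution m b T u0 u \<longleftrightarrow>
     (\<forall>t\<in>time_interval T. u t \<in> laplacian_domain b) \<and>
     (\<forall>x. (\<lambda>t. u t x) C1_differentiable_on time_interval T) \<and>
     (\<forall>x. ((\<lambda>t. u t x) \<longlongrightarrow> u0 x) (at_right 0)) \<and>
     (\<forall>t\<in>time_interval T. \<forall>x.
        ((\<lambda>s. u s x) has_real_derivative - laplacian m b (u t) x) (at t))"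

end

theory Submission imports Defs begin

text \<open>
  The proof is a discrete version of Grigor'yan's integrated maximum principle. Write
  \<open>|x| = d p x\<close> and multiply \<open>|u_t|\<^sup>2\<close> by \<open>\<psi>\<^sup>2 e\<^bsup>-Kt\<^esup>\<close>, where
  \<open>\<psi> = \<eta> exp (- \<rho>\<^sup>2 / (2 c (\<tau> - t)))\<close>, \<open>\<rho>\<close> measures how far \<open>|x|\<close> exceeds roughly \<open>R\<close>, and
  \<open>\<eta>\<close> cuts off inside the ball of radius \<open>A R\<close>. The identity
  \<open>(u x - u y) (u x \<psi>(x)\<^sup>2 - u y \<psi>(y)\<^sup>2) = (u x \<psi>(x) - u y \<psi>(y))\<^sup>2 - u x u y (\<psi>(x) - \<psi>(y))\<^sup>2\<close>
  replaces the chain rule and gives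
  \<open>d/dt \<Sum> u\<^sup>2 \<psi>\<^sup>2 m \<le> \<Sum>\<^sub>x u(x)\<^sup>2 (m(x) \<partial>\<^sub>t \<psi>(x)\<^sup>2 + \<Sum>\<^sub>y b(x,y) (\<psi>(x) - \<psi>(y))\<^sup>2)\<close>
  (lemma \<open>sum_edges_le\<close>).

  The decreasing Gaussian factor has to pay for its own edge differences. On a manifold this is
  the eikonal inequality for \<open>\<rho>\<^sup>2\<close>; on a graph it is disturbed in two ways. The Gaussian
  factors at the two ends of an edge have to be comparable, and an edge contributes although
  \<open>\<rho>\<close> vanishes at one of its ends. Both are controlled by the jump size times
  \<open>1 / (\<tau> - t)\<close>. With \<open>\<tau> - t\<close> of order \<open>R\<^sup>2 / f (A R)\<close> and jumps of size \<open>C R / f (A R)\<close>, as global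
  locality provides outside of the ball of radius \<open>R\<close>, the ratio of the Gaussian factors is
  bounded, and the second disturbance is absorbed by the damping \<open>e\<^bsup>-Kt\<^esup>\<close>, with \<open>K\<close> independent
  of \<open>R\<close> (lemma \<open>weight_edge\<close>). What is left comes from the edges where \<open>\<eta>\<close> varies. There
  the square of the Gaussian factor is at most \<open>exp (- f (A R))\<close>, which is just enough to cancel the growth
  \<open>exp (f (A R))\<close> of the energy. So the damped energy in the ball of radius \<open>R\<close> at a time \<open>t\<^sub>0\<close>
  is at most the one in the ball of radius \<open>A R\<close> at a time \<open>t\<^sub>1 \<ge> t\<^sub>0 - h R\<^sup>2 / f (A R)\<close>, up to an error
  of order \<open>R\<^bsup>-2\<^esup>\<close> (lemma \<open>energy_step\<close>).

  Iterating over the radii \<open>A\<^sup>k R\<close>, the errors form a geometric series (lemma \<open>iterate_scales\<close>),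
  and divergence of \<open>\<integral> r / f(r) dr\<close> says precisely that the time steps add up to infinity (lemma
  \<open>scales_diverge\<close>). Hence time \<open>0\<close>, where \<open>u\<close> vanishes, is reached after finitely many
  steps, and the energy in every large ball of radius \<open>R\<close> is of order \<open>R\<^bsup>-2\<^esup>\<close>. Now let
  \<open>R \<rightarrow> \<infinity>\<close>.
\<close>

section \<open>The space-time weight\<close>

text \<open>A quarter of the relative width of the annulus between the radii \<open>R\<close> and \<open>A R\<close>: three
  quarters separate the region where the cutoff varies from the ball of radius \<open>R\<close>, which leaves
  room for the jumps in between, and the cutoff drops over the last one.\<close>

definition gap :: "real \<Rightarrow> real" where
  "gap A = (A - 1) / 4"

text \<open>A bound for the change of the exponent of \<open>\<psi>\<^sup>2\<close> along an edge. It depends only on the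
  product of the Gaussian constant \<open>c\<close> and the step constant \<open>h\<close>, which is fixed as
  \<open>(gap A)\<^sup>2 / 2\<close>, small enough for the Gaussian factor to beat \<open>exp (f (A R))\<close> where the
  cutoff varies. So \<open>c\<close> can be chosen after this bound, without circularity.\<close>

definition exponent_jump :: "real \<Rightarrow> real \<Rightarrow> real" where
  "exponent_jump A C = 4 * A * C / (gap A)\<^sup>2"

definition gauss_const :: "real \<Rightarrow> real \<Rightarrow> real" where
  "gauss_const A C = 4 * exp (exponent_jump A C)"

definition step_const :: "real \<Rightarrow> real \<Rightarrow> real" where
  "step_const A C = (gap A)\<^sup>2 / (2 * gauss_const A C)"

text \<open>The rate \<open>K\<close> of the damping \<open>e\<^bsup>-Kt\<^esup>\<close>. It compensates the part of the edge differences
  that does not vanish with \<open>\<rho>\<close> and is thus not controlled by the time derivative of the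
  Gaussian factor.\<close>

definition damping :: "real \<Rightarrow> real \<Rightarrow> real" where
  "damping A C = exp (exponent_jump A C) * (2 * C / (gap A)\<^sup>2)\<^sup>2"

lemma exp_diff_square_le:
  fixes a b :: real
  shows "(exp (- a) - exp (- b))\<^sup>2 \<le> (exp (- a))\<^sup>2 * (a - b)\<^sup>2 * exp (2 * \<bar>a - b\<bar>)"
proof -
  have *: "\<bar>1 - exp z\<bar> \<le> \<bar>z\<bar> * exp \<bar>z\<bar>" for z :: real
  proof (cases "z \<ge> 0")
    case True
    have "1 - exp (- z) \<le> z" using exp_ge_add_one_self[of "-z"] by linarith
    then have "(1 - exp (- z)) * exp z \<le> z * exp z" by (intro mult_right_mono) auto
    then have "exp z - 1 \<le> z * exp z" by (simp add: algebra_simps flip: exp_add)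
    with True show ?thesis by simp
  next
    case False
    have "1 - exp z \<le> - z" using exp_ge_add_one_self[of z] by linarith
    also have "\<dots> \<le> (- z) * exp (- z)" using False by (simp add: mult_le_cancel_left1)
    finally show ?thesis using False by simp
  qed
  have "exp (- a) - exp (- b) = exp (- a) * (1 - exp (a - b))"
    by (simp add: algebra_simps flip: exp_add)
  then have "(exp (- a) - exp (- b))\<^sup>2 = (exp (- a))\<^sup>2 * \<bar>1 - exp (a - b)\<bar>\<^sup>2"
    by (simp add: power_mult_distrib)
  also have "\<dots> \<le> (exp (- a))\<^sup>2 * (\<bar>a - b\<bar> * exp \<bar>a - b\<bar>)\<^sup>2"
    by (intro mult_left_mono power_mono *) auto
  also have "\<dots> = (exp (- a))\<^sup>2 * (a - b)\<^sup>2 * exp (2 * \<bar>a - b\<bar>)"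
    by (simp add: power_mult_distrib exp_double)
  finally show ?thesis .
qed

text \<open>The parameters of one step at radius \<open>R\<close>: \<open>S\<close> bounds all jumps, and \<open>F\<close> stands for
  \<open>f (A R)\<close>, so that a jump outside of the ball of radius \<open>R\<close> has size at most \<open>C R / F\<close>.\<close>

locale annulus_weight =
  fixes A C R S F :: real
  assumes A: "A > 1" and C: "C > 0" and R: "R \<ge> 1" and S: "S \<ge> 0"
    and S_small: "3 * S \<le> gap A * R" and F: "F > 0"
begin

definition step :: real where
  "step = step_const A C * R\<^sup>2 / F"

text \<open>The shift by \<open>S\<close> ensures that an edge along which the excess varies has both ends at
  distance at least \<open>R\<close> from the centre, where the smaller jump bound is available.\<close>

definition excess :: "real \<Rightarrow> real" where
  "excess v = max 0 (v - (R + S))"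

definition cutoff :: "real \<Rightarrow> real" where
  "cutoff v = min 1 (max 0 ((A * R - S - v) / (gap A * R)))"

definition weight :: "real \<Rightarrow> real \<Rightarrow> real" where
  "weight \<theta> v = cutoff v * exp (- ((excess v)\<^sup>2 / (2 * gauss_const A C * \<theta>)))"

lemma gap_pos: "gap A > 0"
  using A by (simp add: gap_def)

lemma gauss_pos: "gauss_const A C > 0"
  by (simp add: gauss_const_def)

lemma step_const_pos: "step_const A C > 0"
  using gap_pos gauss_pos by (simp add: step_const_def)

lemma gauss_step: "gauss_const A C * step_const A C = (gap A)\<^sup>2 / 2"
  using gauss_pos by (simp add: step_const_def)

lemma step_pos: "step > 0"
  using step_const_pos F R by (simp add: step_def)

lemma A_gap: "A = 1 + 4 * gap A"
  by (simp add: gap_def diff_divide_distrib)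

text \<open>The eikonal inequality. With \<open>\<rho>\<close> for the excess, the exponent \<open>a = \<rho>\<^sup>2 / (2 c \<theta>)\<close> has a difference along an edge
  of at most \<open>l (2 \<rho>(v) + l) / (2 c \<theta>)\<close>. The term with \<open>\<rho>(v)\<close> is what the time derivative of the
  Gaussian factor can absorb. The remaining term \<open>l\<^sup>2\<close> goes into the damping constant, as
  \<open>l / \<theta>\<close> is bounded by the decay of the jumps and the choice of the time step.\<close>

lemma gauss_factor_edge:
  fixes v w l \<theta> :: real
  assumes v: "0 \<le> v" "v \<le> A * R" and w: "0 \<le> w" "w \<le> A * R"
    and l: "\<bar>v - w\<bar> \<le> l" "l \<le> S"
    and decay: "R \<le> v \<Longrightarrow> R \<le> w \<Longrightarrow> l * F \<le> C * R"
    and \<theta>: "step \<le> \<theta>"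
  defines "a \<equiv> \<lambda>v. (excess v)\<^sup>2 / (2 * gauss_const A C * \<theta>)"
  shows "2 * (exp (- a v) - exp (- a w))\<^sup>2
    \<le> (exp (- a v))\<^sup>2 * (l\<^sup>2 * ((excess v)\<^sup>2 / (gauss_const A C * \<theta>\<^sup>2) + damping A C))"
proof (cases "excess v = excess w")
  case True
  have "damping A C \<ge> 0" by (simp add: damping_def)
  then show ?thesis using True gauss_pos by (simp add: a_def)
next
  case False
  let ?c = "gauss_const A C" and ?M = "exponent_jump A C" and ?h = "step_const A C"
  have \<theta>pos: "\<theta> > 0" using \<theta> step_pos by simp
  have l0: "l \<ge> 0" using l by linarith
  have both: "R \<le> v" "R \<le> w" using False l by (auto simp: excess_def max_def split: if_splits)
  have ex: "0 \<le> excess v" "0 \<le> excess w" "excess v \<le> A * R" "excess w \<le> A * R"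
    "\<bar>excess v - excess w\<bar> \<le> l" "excess v + excess w \<le> 2 * excess v + l"
    using v w l R S A by (auto simp: excess_def max_def)
  have "l \<le> C * R / F" using decay[OF both] F by (simp add: field_simps)
  also have "C * R / F = C * step / (?h * R)"
    using step_const_pos R F by (simp add: step_def field_simps power2_eq_square)
  also have "\<dots> \<le> C * \<theta> / (?h * R)"
    using \<theta> C step_const_pos R by (intro divide_right_mono mult_left_mono) auto
  finally have l_le: "l / \<theta> \<le> C / (?h * R)"
    using \<theta>pos by (simp add: field_simps)
  have "a v - a w = (excess v - excess w) * (excess v + excess w) / (2 * ?c * \<theta>)"
    by (simp add: a_def power2_eq_square diff_divide_distrib[symmetric] algebra_simps)
  then have abs_eq: "\<bar>a v - a w\<bar> = \<bar>excess v - excess w\<bar> * (excess v + excess w) / (2 * ?c * \<theta>)"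
    using ex gauss_pos \<theta>pos by (simp add: abs_mult)
  have abs_le: "\<bar>a v - a w\<bar> \<le> l * X / (2 * ?c * \<theta>)" if "excess v + excess w \<le> X" for X
    unfolding abs_eq using ex gauss_pos \<theta>pos l0 that
    by (intro divide_right_mono mult_mono) auto
  have "2 * \<bar>a v - a w\<bar> \<le> 2 * (l * (2 * A * R) / (2 * ?c * \<theta>))"
    using ex by (intro mult_left_mono abs_le) auto
  also have "\<dots> = 2 * A * R / ?c * (l / \<theta>)" by (simp add: field_simps)
  also have "\<dots> \<le> 2 * A * R / ?c * (C / (?h * R))"
    using A R gauss_pos by (intro mult_left_mono l_le) auto
  also have "\<dots> = 2 * A * C / (?c * ?h)" using R by (simp add: field_simps)
  also have "\<dots> = ?M" unfolding gauss_step exponent_jump_def by (simp add: field_simps)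
  finally have osc: "exp (2 * \<bar>a v - a w\<bar>) \<le> exp ?M" by simp
  have "(a v - a w)\<^sup>2 = \<bar>a v - a w\<bar>\<^sup>2" by simp
  also have "\<dots> \<le> (l * (2 * excess v + l) / (2 * ?c * \<theta>))\<^sup>2"
    using ex by (intro power_mono abs_le) auto
  also have "\<dots> = l\<^sup>2 * (2 * excess v + l)\<^sup>2 / (4 * ?c\<^sup>2 * \<theta>\<^sup>2)"
    by (simp add: power_mult_distrib power_divide)
  also have "\<dots> \<le> l\<^sup>2 * (8 * (excess v)\<^sup>2 + 2 * l\<^sup>2) / (4 * ?c\<^sup>2 * \<theta>\<^sup>2)"
    using sum_squares_bound[of "2 * excess v" l]
    by (intro divide_right_mono mult_left_mono) (auto simp: power2_sum power_mult_distrib)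
  finally have sq: "(a v - a w)\<^sup>2 \<le> l\<^sup>2 * (8 * (excess v)\<^sup>2 + 2 * l\<^sup>2) / (4 * ?c\<^sup>2 * \<theta>\<^sup>2)" .
  have "(l / \<theta>)\<^sup>2 \<le> (C / (?h * R))\<^sup>2"
    using l_le l0 \<theta>pos by (intro power_mono) auto
  also have "\<dots> \<le> (C / ?h)\<^sup>2"
    using R C step_const_pos by (intro power_mono divide_left_mono) auto
  finally have "exp ?M / ?c\<^sup>2 * (l / \<theta>)\<^sup>2 \<le> exp ?M / ?c\<^sup>2 * (C / ?h)\<^sup>2"
    by (intro mult_left_mono) auto
  also have "\<dots> = exp ?M * (C / (?c * ?h))\<^sup>2" by (simp add: power_divide power_mult_distrib)
  also have "\<dots> = damping A C" unfolding gauss_step damping_def by (simp add: field_simps)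
  finally have damp: "exp ?M / ?c\<^sup>2 * (l / \<theta>)\<^sup>2 \<le> damping A C" .
  have "2 * (exp (- a v) - exp (- a w))\<^sup>2
      \<le> 2 * ((exp (- a v))\<^sup>2 * (a v - a w)\<^sup>2 * exp (2 * \<bar>a v - a w\<bar>))"
    by (intro mult_left_mono exp_diff_square_le) auto
  also have "\<dots> \<le> 2 * ((exp (- a v))\<^sup>2 * (l\<^sup>2 * (8 * (excess v)\<^sup>2 + 2 * l\<^sup>2) / (4 * ?c\<^sup>2 * \<theta>\<^sup>2)) * exp ?M)"
    using sq osc by (intro mult_left_mono mult_mono) auto
  also have "\<dots> = (exp (- a v))\<^sup>2 * (l\<^sup>2 * (4 * exp ?M / ?c\<^sup>2 * ((excess v)\<^sup>2 / \<theta>\<^sup>2)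
      + exp ?M / ?c\<^sup>2 * (l / \<theta>)\<^sup>2))"
    using gauss_pos \<theta>pos by (simp add: field_simps)
  also have "4 * exp ?M / ?c\<^sup>2 * ((excess v)\<^sup>2 / \<theta>\<^sup>2) = (excess v)\<^sup>2 / (?c * \<theta>\<^sup>2)"
    by (simp add: gauss_const_def power2_eq_square)
  also have "(exp (- a v))\<^sup>2 * (l\<^sup>2 * ((excess v)\<^sup>2 / (?c * \<theta>\<^sup>2) + exp ?M / ?c\<^sup>2 * (l / \<theta>)\<^sup>2))
      \<le> (exp (- a v))\<^sup>2 * (l\<^sup>2 * ((excess v)\<^sup>2 / (?c * \<theta>\<^sup>2) + damping A C))"
    using damp by (intro mult_left_mono) auto
  finally show ?thesis .
qed

text \<open>If the cutoff varies along an edge, both of its ends have excess at least \<open>gap A * R\<close>. The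
  step length is such that the square of the Gaussian factor is then at most \<open>exp (- F)\<close>.\<close>

lemma cutoff_edge:
  fixes v w l \<theta> :: real
  assumes l: "\<bar>v - w\<bar> \<le> l" "l \<le> S" and \<theta>: "0 < \<theta>" "\<theta> \<le> 2 * step"
  shows "(exp (- ((excess w)\<^sup>2 / (2 * gauss_const A C * \<theta>))))\<^sup>2 * (cutoff v - cutoff w)\<^sup>2
    \<le> exp (- F) * (l\<^sup>2 / (gap A * R)\<^sup>2)"
proof (cases "cutoff v = cutoff w")
  case False
  let ?c = "gauss_const A C"
  have gR: "gap A * R > 0" using gap_pos R by simp
  have "\<not> (v \<le> A * R - S - gap A * R \<and> w \<le> A * R - S - gap A * R)"
  proof
    assume asm: "v \<le> A * R - S - gap A * R \<and> w \<le> A * R - S - gap A * R"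
    have "cutoff z = 1" if "z \<le> A * R - S - gap A * R" for z
    proof -
      have "(A * R - S - z) / (gap A * R) \<ge> 1" using that gR by (simp only: le_divide_eq) simp
      then show ?thesis by (simp add: cutoff_def)
    qed
    with asm False show False by simp
  qed
  then have "w > A * R - 2 * S - gap A * R" using l by auto
  moreover have "A * R = R + 4 * (gap A * R)" using A_gap by (metis distrib_right mult_1 mult.assoc)
  ultimately have ex: "excess w \<ge> gap A * R"
    using S_small gR unfolding excess_def by linarith
  have "F = (gap A * R)\<^sup>2 / (?c * (2 * step))"
  proof -
    have "?c * (2 * step) = 2 * (?c * step_const A C) * R\<^sup>2 / F" by (simp add: step_def)
    also have "\<dots> = (gap A * R)\<^sup>2 / F" unfolding gauss_step by (simp add: power_mult_distrib)
    finally have "?c * (2 * step) = (gap A * R)\<^sup>2 / F" .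
    then show ?thesis using gap_pos R F by simp
  qed
  also have "\<dots> \<le> (excess w)\<^sup>2 / (?c * \<theta>)"
    using ex gR \<theta> gauss_pos by (intro frac_le power_mono) auto
  finally have "F \<le> (excess w)\<^sup>2 / (?c * \<theta>)" .
  then have E: "(exp (- ((excess w)\<^sup>2 / (2 * ?c * \<theta>))))\<^sup>2 \<le> exp (- F)"
    by (simp add: field_simps flip: exp_double)
  have "\<bar>cutoff v - cutoff w\<bar> \<le> \<bar>(A * R - S - v) / (gap A * R) - (A * R - S - w) / (gap A * R)\<bar>"
    unfolding cutoff_def by linarith
  also have "\<dots> = \<bar>v - w\<bar> / (gap A * R)"
    using gR by (simp add: diff_divide_distrib[symmetric] abs_minus_commute)
  also have "\<dots> \<le> l / (gap A * R)" using l gR by (intro divide_right_mono) auto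
  finally have "\<bar>cutoff v - cutoff w\<bar>\<^sup>2 \<le> (l / (gap A * R))\<^sup>2" by (intro power_mono) auto
  then show ?thesis using E by (intro mult_mono) (auto simp: power_divide)
qed simp

text \<open>The product rule for differences combines the two factors; taking the cutoff at \<open>v\<close>
  in one term and the Gaussian factor at \<open>w\<close> in the other matches the two preceding estimates.\<close>

lemma weight_edge:
  fixes v w l \<theta> :: real
  assumes v: "0 \<le> v" "v \<le> A * R" and w: "0 \<le> w" "w \<le> A * R"
    and l: "\<bar>v - w\<bar> \<le> l" "l \<le> S"
    and decay: "R \<le> v \<Longrightarrow> R \<le> w \<Longrightarrow> l * F \<le> C * R"
    and \<theta>: "step \<le> \<theta>" "\<theta> \<le> 2 * step"
  shows "(weight \<theta> v - weight \<theta> w)\<^sup>2 \<le> l\<^sup>2 *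
    ((weight \<theta> v)\<^sup>2 * ((excess v)\<^sup>2 / (gauss_const A C * \<theta>\<^sup>2) + damping A C)
      + 2 * exp (- F) / (gap A * R)\<^sup>2)"
proof -
  define E where "E = (\<lambda>v. exp (- ((excess v)\<^sup>2 / (2 * gauss_const A C * \<theta>))))"
  let ?k = "(excess v)\<^sup>2 / (gauss_const A C * \<theta>\<^sup>2) + damping A C"
  have \<theta>pos: "0 < \<theta>" using \<theta> step_pos by simp
  have w_eq: "weight \<theta> z = cutoff z * E z" for z by (simp add: weight_def E_def)
  have split: "weight \<theta> v - weight \<theta> w = cutoff v * (E v - E w) + E w * (cutoff v - cutoff w)"
    by (simp add: w_eq algebra_simps)
  have "(weight \<theta> v - weight \<theta> w)\<^sup>2
      \<le> 2 * (cutoff v * (E v - E w))\<^sup>2 + 2 * (E w * (cutoff v - cutoff w))\<^sup>2"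
    unfolding split
    using sum_squares_bound[of "cutoff v * (E v - E w)" "E w * (cutoff v - cutoff w)"]
    by (simp add: power2_sum)
  also have "\<dots> = (cutoff v)\<^sup>2 * (2 * (E v - E w)\<^sup>2) + 2 * ((E w)\<^sup>2 * (cutoff v - cutoff w)\<^sup>2)"
    by (simp add: power_mult_distrib)
  also have "\<dots> \<le> (cutoff v)\<^sup>2 * ((E v)\<^sup>2 * (l\<^sup>2 * ?k)) + 2 * (exp (- F) * (l\<^sup>2 / (gap A * R)\<^sup>2))"
    using gauss_factor_edge[OF v w l decay \<theta>(1)] cutoff_edge[OF l \<theta>pos \<theta>(2)]
    by (intro add_mono mult_left_mono) (auto simp: E_def)
  also have "\<dots> = l\<^sup>2 * ((weight \<theta> v)\<^sup>2 * ?k + 2 * exp (- F) / (gap A * R)\<^sup>2)"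
    by (simp add: w_eq power_mult_distrib algebra_simps)
  finally show ?thesis .
qed

lemma weight_square_deriv:
  assumes "t < \<tau>"
  shows "((\<lambda>t. (weight (\<tau> - t) v)\<^sup>2) has_real_derivative
    - ((weight (\<tau> - t) v)\<^sup>2 * ((excess v)\<^sup>2 / (gauss_const A C * (\<tau> - t)\<^sup>2)))) (at t)"
proof -
  \<comment> \<open>The inverse keeps the derivative of the exponent in a form that needs no common denominators.\<close>
  have sq: "(weight \<theta> v)\<^sup>2 = (cutoff v)\<^sup>2 * exp (- ((excess v)\<^sup>2 / gauss_const A C * inverse \<theta>))" for \<theta>
    by (simp add: weight_def power_mult_distrib field_simps flip: exp_double)
  have "\<tau> - t \<noteq> 0" using assms by auto
  then show ?thesis unfolding sq
    by (auto intro!: derivative_eq_intros simp: power2_eq_square divide_inverse)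
qed

lemma weight_bounded: "(weight \<theta> v)\<^sup>2 \<le> 1" if "\<theta> > 0"
proof -
  have "0 \<le> cutoff v" "cutoff v \<le> 1" by (auto simp: cutoff_def)
  moreover have "exp (- ((excess v)\<^sup>2 / (2 * gauss_const A C * \<theta>))) \<le> 1"
    using that gauss_pos by simp
  ultimately have "0 \<le> weight \<theta> v" "weight \<theta> v \<le> 1"
    unfolding weight_def by (auto intro!: mult_le_one)
  then show ?thesis by (simp add: power_le_one)
qed

lemma weight_inner: "weight \<theta> v = 1" if "v \<le> R"
proof -
  have gR: "gap A * R > 0" using gap_pos R by simp
  have "A * R = R + 4 * (gap A * R)" using A_gap by (metis distrib_right mult_1 mult.assoc)
  then have "(A * R - S - v) / (gap A * R) \<ge> 1"
    using that S_small S gR by (simp only: le_divide_eq if_True)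
  then show ?thesis using that S by (simp add: weight_def cutoff_def excess_def)
qed

lemma weight_outer: "weight \<theta> v = 0" if "A * R - S \<le> v"
proof -
  have gR: "gap A * R > 0" using gap_pos R by simp
  have "(A * R - S - v) / (gap A * R) \<le> 0" using that gR by (simp add: divide_le_0_iff)
  then show ?thesis by (simp add: weight_def cutoff_def)
qed

end

section \<open>Energy decay for the heat equation\<close>

text \<open>Green's formula followed by the edgewise identity from the introduction, in which the
  square \<open>(u x \<psi>(x) - u y \<psi>(y))\<^sup>2\<close> is dropped and \<open>2 u x u y \<le> u(x)\<^sup>2 + u(y)\<^sup>2\<close>. Symmetry of \<open>b\<close> is used
  to sum over unordered pairs.\<close>

lemma sum_edges_le:
  fixes b :: "'a \<Rightarrow> 'a \<Rightarrow> real" and u \<psi> :: "'a \<Rightarrow> real"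
  assumes sym: "\<And>x y. b x y = b y x" and nonneg: "\<And>x y. b x y \<ge> 0"
  shows "2 * (\<Sum>x\<in>N. u x * (\<psi> x)\<^sup>2 * (\<Sum>y\<in>N. b x y * (u y - u x)))
    \<le> (\<Sum>x\<in>N. (u x)\<^sup>2 * (\<Sum>y\<in>N. b x y * (\<psi> x - \<psi> y)\<^sup>2))"
proof -
  define g where "g = (\<lambda>x y. u x * (\<psi> x)\<^sup>2 * (b x y * (u y - u x)))"
  define e where "e = (\<lambda>x y. (u x)\<^sup>2 * (b x y * (\<psi> x - \<psi> y)\<^sup>2))"
  have swap: "(\<Sum>x\<in>N. \<Sum>y\<in>N. q y x) = (\<Sum>x\<in>N. \<Sum>y\<in>N. q x y)" for q :: "'a \<Rightarrow> 'a \<Rightarrow> real"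
    by (rule sum.swap)
  have edge: "2 * (g x y + g y x) \<le> e x y + e y x" for x y
  proof -
    have "g x y + g y x = b x y * (u x * u y * (\<psi> x - \<psi> y)\<^sup>2 - (u x * \<psi> x - u y * \<psi> y)\<^sup>2)"
      by (simp add: g_def sym[of y x] power2_eq_square algebra_simps)
    then have "2 * (g x y + g y x)
        = b x y * (2 * u x * u y * (\<psi> x - \<psi> y)\<^sup>2 - 2 * (u x * \<psi> x - u y * \<psi> y)\<^sup>2)"
      by (simp add: algebra_simps)
    also have "\<dots> \<le> b x y * (((u x)\<^sup>2 + (u y)\<^sup>2) * (\<psi> x - \<psi> y)\<^sup>2 - 0)"
      using sum_squares_bound[of "u x" "u y"]
      by (intro mult_left_mono[OF _ nonneg] diff_mono mult_right_mono) auto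
    also have "\<dots> = e x y + e y x"
      by (simp add: e_def sym[of y x] power2_commute[of "\<psi> y"] algebra_simps)
    finally show ?thesis .
  qed
  have "4 * (\<Sum>x\<in>N. \<Sum>y\<in>N. g x y) = (\<Sum>x\<in>N. \<Sum>y\<in>N. 2 * (g x y + g y x))"
    by (simp add: sum.distrib swap[of g] flip: sum_distrib_left)
  also have "\<dots> \<le> (\<Sum>x\<in>N. \<Sum>y\<in>N. e x y + e y x)"
    by (intro sum_mono edge)
  also have "\<dots> = 2 * (\<Sum>x\<in>N. \<Sum>y\<in>N. e x y)"
    by (simp add: sum.distrib swap[of e])
  finally have "2 * (\<Sum>x\<in>N. \<Sum>y\<in>N. g x y) \<le> (\<Sum>x\<in>N. \<Sum>y\<in>N. e x y)"
    by simp
  then show ?thesis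
    by (simp only: g_def e_def sum_distrib_left)
qed

lemma time_interval_mono:
  assumes "t0 \<in> time_interval T" "0 < t" "t \<le> t0"
  shows "t \<in> time_interval T"
  using assms le_less_trans[of "ereal t" "ereal t0" T] by (simp add: time_interval_def)

text \<open>A finite jump size together with finite balls makes the graph locally finite, so only
  finite sums over balls occur below.\<close>

locale heat_on_graph =
  fixes m :: "'a \<Rightarrow> real"
    and b d :: "'a \<Rightarrow> 'a \<Rightarrow> real"
    and p :: 'a
    and S :: real
    and T :: ereal
    and u :: "real \<Rightarrow> 'a \<Rightarrow> real"
  assumes graph: "weighted_graph m b"
    and intr: "intrinsic m b d"
    and balls: "\<And>r. r \<ge> 0 \<Longrightarrow> finite (dist_ball d p r)"
    and jump: "\<And>x y. b x y > 0 \<Longrightarrow> d x y \<le> S"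
    and heat: "heat_solution m b T (\<lambda>x. 0) u"
begin

definition ball_energy :: "real \<Rightarrow> real \<Rightarrow> real" where
  "ball_energy r t = (\<Sum>x\<in>dist_ball d p r. \<bar>u t x\<bar>\<^sup>2 * m x)"

lemma m_pos: "m x > 0" and b_nonneg: "b x y \<ge> 0" and b_sym: "b x y = b y x"
  using graph unfolding weighted_graph_def by blast+

lemma d_nonneg: "d x y \<ge> 0" and d_sym: "d x y = d y x" and d_triangle: "d x z \<le> d x y + d y z"
  using intr unfolding intrinsic_def pseudo_metric_def by blast+

lemma d_lipschitz: "\<bar>d p x - d p y\<bar> \<le> d x y"
  using d_triangle[of p x y] d_triangle[of p y x] d_sym[of x y] by linarith

lemma intrinsic_sum:
  assumes "finite N"
  shows "(\<Sum>y\<in>N. b x y * (d x y)\<^sup>2) \<le> m x"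
proof -
  have "(\<Sum>y\<in>N. b x y * (d x y)\<^sup>2) \<le> (\<Sum>\<^sub>\<infinity>y. b x y * (d x y)\<^sup>2)"
    using intr assms unfolding intrinsic_def
    by (intro finite_sum_le_infsum) (auto simp: b_nonneg)
  also have "\<dots> \<le> m x" using intr unfolding intrinsic_def by blast
  finally show ?thesis .
qed

lemma laplacian_finite_sum:
  assumes "finite N" "\<And>y. b x y > 0 \<Longrightarrow> y \<in> N"
  shows "m x * - laplacian m b g x = (\<Sum>y\<in>N. b x y * (g y - g x))"
proof -
  have "b x y = 0" if "y \<notin> N" for y
    using that assms(2)[of y] b_nonneg[of x y] by fastforce
  then have "(\<Sum>\<^sub>\<infinity>y. b x y * (g x - g y)) = (\<Sum>\<^sub>\<infinity>y\<in>N. b x y * (g x - g y))"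
    by (intro infsum_cong_neutral) auto
  also have "\<dots> = (\<Sum>y\<in>N. b x y * (g x - g y))" using assms(1) by simp
  finally show ?thesis
    using m_pos[of x] by (simp add: laplacian_def flip: sum_negf) (simp add: algebra_simps)
qed

lemma u_deriv:
  "t \<in> time_interval T \<Longrightarrow> ((\<lambda>s. u s x) has_real_derivative - laplacian m b (u t) x) (at t)"
  using heat unfolding heat_solution_def by blast

text \<open>The damped and weighted energy \<open>\<Phi>\<close> grows at most with rate \<open>\<epsilon>\<close> times the energy in the
  ball of radius \<open>A R\<close>, and \<open>\<epsilon>\<close> contains the factor \<open>exp (- F)\<close> that cancels the growth bound after
  integration over time. The weight is 1 on the ball of radius \<open>R\<close> and at most 1 everywhere.\<close>

lemma energy_step:
  assumes aw: "annulus_weight A C R S F"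
    and decay: "\<And>x y. b x y > 0 \<Longrightarrow> R \<le> d p x \<Longrightarrow> R \<le> d p y \<Longrightarrow> d x y * F \<le> C * R"
    and time: "0 < t1" "t1 \<le> t0" "t0 \<in> time_interval T" "t0 - t1 \<le> step_const A C * R\<^sup>2 / F"
    and growth: "(\<integral>\<^sup>+t\<in>time_interval T. ennreal (ball_energy (A * R) t) \<partial>lborel) \<le> ennreal (exp F)"
  shows "exp (- (damping A C * t0)) * ball_energy R t0
    \<le> exp (- (damping A C * t1)) * ball_energy (A * R) t1 + 2 / (gap A * R)\<^sup>2"
proof -
  interpret annulus_weight A C R S F by fact
  define N where "N = dist_ball d p (A * R)"
  \<comment> \<open>Placing the singularity one step after \<open>t0\<close> keeps \<open>\<tau> - t\<close> between one and two steps.\<close>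
  define \<tau> where "\<tau> = t0 + step"
  define K where "K = damping A C"
  define \<psi> where "\<psi> = (\<lambda>t x. weight (\<tau> - t) (d p x))"
  define k where "k = (\<lambda>t x. (excess (d p x))\<^sup>2 / (gauss_const A C * (\<tau> - t)\<^sup>2))"
  define \<epsilon> where "\<epsilon> = 2 * exp (- F) / (gap A * R)\<^sup>2"
  define \<Phi> where "\<Phi> = (\<lambda>t. exp (- (K * t)) * (\<Sum>x\<in>N. (\<psi> t x)\<^sup>2 * ((u t x)\<^sup>2 * m x)))"
  define \<Phi>' where "\<Phi>' = (\<lambda>t. exp (- (K * t)) *
    (\<Sum>x\<in>N. - (\<psi> t x)\<^sup>2 * (k t x + K) * ((u t x)\<^sup>2 * m x)
      + 2 * (u t x * (\<psi> t x)\<^sup>2 * (m x * - laplacian m b (u t) x))))"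
  let ?H = "ball_energy (A * R)"
  have AR: "A * R \<ge> 0" "R \<le> A * R" using A R by auto
  have finN: "finite N" using balls AR by (simp add: N_def)
  have K0: "K \<ge> 0" by (simp add: K_def damping_def)
  have \<epsilon>0: "\<epsilon> \<ge> 0" by (simp add: \<epsilon>_def)
  have H_eq: "?H t = (\<Sum>x\<in>N. (u t x)\<^sup>2 * m x)" for t by (simp add: ball_energy_def N_def)
  have inT: "t \<in> time_interval T" if "t \<in> {t1..t0}" for t
    using that time by (intro time_interval_mono[OF time(3)]) auto
  have \<theta>: "step \<le> \<tau> - t" "\<tau> - t \<le> 2 * step" "t < \<tau>" if "t \<in> {t1..t0}" for t
    using that time(4) step_pos by (auto simp: \<tau>_def step_def)
  have deriv: "(\<Phi> has_real_derivative \<Phi>' t) (at t)" if t: "t \<in> {t1..t0}" for t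
  proof -
    have psi_deriv: "((\<lambda>t. (\<psi> t x)\<^sup>2) has_real_derivative - ((\<psi> t x)\<^sup>2 * k t x)) (at t)" for x
      unfolding \<psi>_def k_def by (rule weight_square_deriv[OF \<theta>(3)[OF t]])
    have "((\<lambda>t. (u t x)\<^sup>2 * m x) has_real_derivative 2 * u t x * - laplacian m b (u t) x * m x) (at t)" for x
      by (auto intro!: derivative_eq_intros u_deriv[OF inT[OF t]])
    from DERIV_sum[OF DERIV_mult[OF psi_deriv this]]
    have "((\<lambda>t. \<Sum>x\<in>N. (\<psi> t x)\<^sup>2 * ((u t x)\<^sup>2 * m x)) has_real_derivative
      (\<Sum>x\<in>N. - ((\<psi> t x)\<^sup>2 * k t x) * ((u t x)\<^sup>2 * m x)
        + 2 * u t x * - laplacian m b (u t) x * m x * (\<psi> t x)\<^sup>2)) (at t)" .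
    moreover have "((\<lambda>t. exp (- (K * t))) has_real_derivative - K * exp (- (K * t))) (at t)"
      by (auto intro!: derivative_eq_intros)
    ultimately show ?thesis unfolding \<Phi>_def \<Phi>'_def
      by (rule DERIV_cong[OF DERIV_mult[rotated]])
        (simp add: sum_distrib_left sum_distrib_right algebra_simps flip: sum.distrib)
  qed
  have local_ineq: "\<Phi>' t \<le> \<epsilon> * ?H t" if t: "t \<in> {t1..t0}" for t
  proof -
    \<comment> \<open>On the support of the weight the Laplacian only sees vertices of \<open>N\<close>.\<close>
    have "\<psi> t x * (m x * - laplacian m b (u t) x) = \<psi> t x * (\<Sum>y\<in>N. b x y * (u t y - u t x))" for x
    proof (cases "\<psi> t x = 0")
      case False
      then have "d p x < A * R - S" using weight_outer unfolding \<psi>_def by (meson not_less)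
      then have "y \<in> N" if "b x y > 0" for y
        using jump[OF that] d_triangle[of p y x] by (simp add: N_def dist_ball_def)
      then show ?thesis using laplacian_finite_sum[OF finN] by simp
    qed simp
    then have lap: "u t x * (\<psi> t x)\<^sup>2 * (m x * - laplacian m b (u t) x)
        = u t x * (\<psi> t x)\<^sup>2 * (\<Sum>y\<in>N. b x y * (u t y - u t x))" for x
      by (simp only: power2_eq_square mult.assoc)
    have edges: "(\<Sum>y\<in>N. b x y * (\<psi> t x - \<psi> t y)\<^sup>2) \<le> m x * ((\<psi> t x)\<^sup>2 * (k t x + K) + \<epsilon>)"
      if x: "x \<in> N" for x
    proof -
      let ?q = "(\<psi> t x)\<^sup>2 * (k t x + K) + \<epsilon>"
      have q0: "?q \<ge> 0" using K0 \<epsilon>0 gauss_pos by (simp add: k_def)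
      have "b x y * (\<psi> t x - \<psi> t y)\<^sup>2 \<le> b x y * (d x y)\<^sup>2 * ?q" if y: "y \<in> N" for y
      proof (cases "b x y > 0")
        case True
        have "(\<psi> t x - \<psi> t y)\<^sup>2 \<le> (d x y)\<^sup>2 * ?q"
          unfolding \<psi>_def k_def K_def \<epsilon>_def
          using x y by (intro weight_edge d_lipschitz jump decay True \<theta>[OF t])
            (auto simp: N_def dist_ball_def d_nonneg)
        then show ?thesis using b_nonneg[of x y] by (simp add: mult.assoc mult_left_mono)
      next
        case False
        then show ?thesis using b_nonneg[of x y] by simp
      qed
      then have "(\<Sum>y\<in>N. b x y * (\<psi> t x - \<psi> t y)\<^sup>2) \<le> (\<Sum>y\<in>N. b x y * (d x y)\<^sup>2 * ?q)"
        by (intro sum_mono)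
      also have "\<dots> = (\<Sum>y\<in>N. b x y * (d x y)\<^sup>2) * ?q" by (simp add: sum_distrib_right)
      also have "\<dots> \<le> m x * ?q" by (intro mult_right_mono intrinsic_sum finN q0)
      finally show ?thesis .
    qed
    have "(\<Sum>x\<in>N. - (\<psi> t x)\<^sup>2 * (k t x + K) * ((u t x)\<^sup>2 * m x)
          + 2 * (u t x * (\<psi> t x)\<^sup>2 * (m x * - laplacian m b (u t) x)))
        = (\<Sum>x\<in>N. - (\<psi> t x)\<^sup>2 * (k t x + K) * ((u t x)\<^sup>2 * m x))
          + 2 * (\<Sum>x\<in>N. u t x * (\<psi> t x)\<^sup>2 * (\<Sum>y\<in>N. b x y * (u t y - u t x)))"
      unfolding lap by (simp only: sum.distrib flip: sum_distrib_left)
    also have "\<dots> \<le> (\<Sum>x\<in>N. - (\<psi> t x)\<^sup>2 * (k t x + K) * ((u t x)\<^sup>2 * m x))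
          + (\<Sum>x\<in>N. (u t x)\<^sup>2 * (\<Sum>y\<in>N. b x y * (\<psi> t x - \<psi> t y)\<^sup>2))"
      by (intro add_left_mono sum_edges_le b_sym b_nonneg)
    also have "\<dots> \<le> (\<Sum>x\<in>N. - (\<psi> t x)\<^sup>2 * (k t x + K) * ((u t x)\<^sup>2 * m x))
          + (\<Sum>x\<in>N. (u t x)\<^sup>2 * (m x * ((\<psi> t x)\<^sup>2 * (k t x + K) + \<epsilon>)))"
      by (intro add_left_mono sum_mono mult_left_mono edges) auto
    also have "\<dots> = \<epsilon> * ?H t"
      unfolding H_eq by (simp add: sum_distrib_left algebra_simps flip: sum.distrib)
    finally have "\<Phi>' t \<le> exp (- (K * t)) * (\<epsilon> * ?H t)"
      unfolding \<Phi>'_def by (intro mult_left_mono) auto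
    also have "\<dots> \<le> 1 * (\<epsilon> * ?H t)"
    proof (intro mult_right_mono mult_nonneg_nonneg \<epsilon>0)
      show "exp (- (K * t)) \<le> 1" using K0 t time(1) by simp
      show "0 \<le> ?H t" unfolding H_eq by (simp add: sum_nonneg less_imp_le[OF m_pos])
    qed
    finally show ?thesis by simp
  qed
  have cont: "continuous_on {t1..t0} ?H"
    unfolding H_eq
    by (intro continuous_intros continuous_at_imp_continuous_on ballI DERIV_isCont[OF u_deriv] inT)
  define I where "I = integral {t1..t0} ?H"
  have I: "(?H has_integral I) {t1..t0}"
    unfolding I_def by (intro integrable_integral integrable_continuous_real cont)
  have "ennreal I = (\<integral>\<^sup>+t\<in>{t1..t0}. ennreal (?H t) \<partial>lborel)"
    using nn_integral_has_integral_lebesgue'[OF _ I] m_pos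
    by (simp add: H_eq sum_nonneg less_imp_le)
  also have "\<dots> \<le> (\<integral>\<^sup>+t\<in>time_interval T. ennreal (?H t) \<partial>lborel)"
    using inT by (intro nn_integral_mono) (auto split: split_indicator)
  also note growth
  finally have I_le: "I \<le> exp F" by (simp add: ennreal_le_iff)
  have "(\<Phi>' has_integral (\<Phi> t0 - \<Phi> t1)) {t1..t0}"
    using deriv time(2)
    by (intro fundamental_theorem_of_calculus)
      (auto simp flip: has_real_derivative_iff_has_vector_derivative intro: has_field_derivative_at_within)
  then have "\<Phi> t0 - \<Phi> t1 \<le> \<epsilon> * I"
    using local_ineq by (rule has_integral_le[OF _ has_integral_mult_right[OF I]])
  also have "\<dots> \<le> \<epsilon> * exp F" using I_le \<epsilon>0 by (rule mult_left_mono)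
  also have "\<dots> = 2 / (gap A * R)\<^sup>2" by (simp add: \<epsilon>_def exp_minus field_simps)
  finally have "\<Phi> t0 \<le> \<Phi> t1 + 2 / (gap A * R)\<^sup>2" by simp
  moreover have "exp (- (K * t0)) * ball_energy R t0 \<le> \<Phi> t0"
  proof -
    have "ball_energy R t0 = (\<Sum>x\<in>dist_ball d p R. (\<psi> t0 x)\<^sup>2 * ((u t0 x)\<^sup>2 * m x))"
      unfolding ball_energy_def by (intro sum.cong) (auto simp: \<psi>_def dist_ball_def weight_inner)
    also have "\<dots> \<le> (\<Sum>x\<in>N. (\<psi> t0 x)\<^sup>2 * ((u t0 x)\<^sup>2 * m x))"
      using AR m_pos by (intro sum_mono2 finN) (auto simp: N_def dist_ball_def less_imp_le)
    finally show ?thesis unfolding \<Phi>_def by simp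
  qed
  moreover have "\<Phi> t1 \<le> exp (- (K * t1)) * ?H t1"
  proof -
    have "(\<psi> t1 x)\<^sup>2 \<le> 1" for x
      using \<theta>[of t1] time(2) weight_bounded[of "\<tau> - t1"] by (simp add: \<psi>_def)
    then have "(\<psi> t1 x)\<^sup>2 * ((u t1 x)\<^sup>2 * m x) \<le> 1 * ((u t1 x)\<^sup>2 * m x)" for x
      using m_pos by (intro mult_right_mono) (auto simp: less_imp_le)
    then show ?thesis unfolding \<Phi>_def H_eq by (auto intro!: mult_left_mono sum_mono)
  qed
  ultimately show ?thesis by (simp add: K_def)
qed

lemma ball_energy_initial: "(ball_energy r \<longlongrightarrow> 0) (at_right 0)"
proof -
  have "((\<lambda>t. u t x) \<longlongrightarrow> 0) (at_right 0)" for x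
    using heat unfolding heat_solution_def by blast
  then have "(ball_energy r \<longlongrightarrow> (\<Sum>x\<in>dist_ball d p r. \<bar>0\<bar>\<^sup>2 * m x)) (at_right 0)"
    unfolding ball_energy_def by (intro tendsto_intros)
  then show ?thesis by simp
qed

end


section \<open>Geometric scales\<close>

text \<open>Each step enlarges the radius by \<open>A\<close> and goes back in time by at most \<open>\<delta> R\<close>; the last one is
  shortened so as to stop at \<open>s\<close>.\<close>

lemma iterate_scales:
  fixes \<Phi> :: "real \<Rightarrow> real \<Rightarrow> real" and \<delta> :: "real \<Rightarrow> real" and A D R0 t0 :: real
  assumes step: "\<And>R s t. R0 \<le> R \<Longrightarrow> 0 < s \<Longrightarrow> s \<le> t \<Longrightarrow> t \<le> t0 \<Longrightarrow> t - s \<le> \<delta> R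
      \<Longrightarrow> \<Phi> R t \<le> \<Phi> (A * R) s + D / R\<^sup>2"
    and A: "A > 1" and R0: "R0 > 0" and \<delta>: "\<And>R. R0 \<le> R \<Longrightarrow> 0 \<le> \<delta> R"
  shows "R0 \<le> R \<Longrightarrow> 0 < s \<Longrightarrow> s \<le> t \<Longrightarrow> t \<le> t0 \<Longrightarrow> t - s \<le> (\<Sum>k<n. \<delta> (A ^ k * R))
    \<Longrightarrow> \<Phi> R t \<le> \<Phi> (A ^ n * R) s + D / R\<^sup>2 * (\<Sum>k<n. (1 / A\<^sup>2) ^ k)"
proof (induction n arbitrary: R t)
  case 0
  then show ?case by simp
next
  case (Suc n)
  define t' where "t' = max s (t - \<delta> R)"
  have R_le: "R \<le> A * R" using A R0 Suc.prems(1) by simp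
  have sum_split: "(\<Sum>k<Suc n. \<delta> (A ^ k * R)) = \<delta> R + (\<Sum>k<n. \<delta> (A ^ k * (A * R)))"
    unfolding sum.lessThan_Suc_shift by (simp add: mult_ac)
  have "0 \<le> \<delta> (A ^ k * (A * R))" for k
  proof -
    have "1 * R \<le> A ^ k * (A * R)" using A R_le R0 Suc.prems(1) by (intro mult_mono) auto
    then show ?thesis using Suc.prems(1) by (intro \<delta>) simp
  qed
  then have "0 \<le> (\<Sum>k<n. \<delta> (A ^ k * (A * R)))" by (intro sum_nonneg)
  then have t': "s \<le> t'" "t' \<le> t" "t - t' \<le> \<delta> R" "t' - s \<le> (\<Sum>k<n. \<delta> (A ^ k * (A * R)))"
    using Suc.prems(3,5) \<delta>[OF Suc.prems(1)] unfolding t'_def sum_split by auto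
  have "\<Phi> R t \<le> \<Phi> (A * R) t' + D / R\<^sup>2"
    using Suc.prems t' by (intro step) auto
  also have "\<Phi> (A * R) t' \<le> \<Phi> (A ^ n * (A * R)) s + D / (A * R)\<^sup>2 * (\<Sum>k<n. (1 / A\<^sup>2) ^ k)"
    using Suc.prems t' R_le by (intro Suc.IH) auto
  also have "\<Phi> (A ^ n * (A * R)) s + D / (A * R)\<^sup>2 * (\<Sum>k<n. (1 / A\<^sup>2) ^ k) + D / R\<^sup>2
      = \<Phi> (A ^ Suc n * R) s + D / R\<^sup>2 * (\<Sum>k<Suc n. (1 / A\<^sup>2) ^ k)"
  proof -
    have "(\<Sum>k<Suc n. (1 / A\<^sup>2) ^ k) = 1 + 1 / A\<^sup>2 * (\<Sum>k<n. (1 / A\<^sup>2) ^ k)"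
      unfolding sum.lessThan_Suc_shift sum_distrib_left by simp
    then show ?thesis by (simp add: power_mult_distrib distrib_left mult_ac del: sum.lessThan_Suc)
  qed
  finally show ?case by simp
qed

text \<open>Since \<open>f\<close> increases, the integral of \<open>r / f(r)\<close> over the interval from \<open>A\<^bsup>k+1\<^esup> R\<close> to
  \<open>A\<^bsup>k+2\<^esup> R\<close> is at most \<open>A\<^sup>4 / h\<close> times the \<open>k\<close>-th time step. Bounded sums of time steps
  would therefore make the whole integral finite.\<close>

lemma scales_diverge:
  fixes f :: "real \<Rightarrow> real" and A R h t :: real
  assumes f_pos: "\<And>r. r > 0 \<Longrightarrow> f r > 0" and f_mono: "mono_on {0<..} f"
    and div: "(\<integral>\<^sup>+r\<in>{1..}. ennreal (r / f r) \<partial>lborel) = \<infinity>"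
    and A: "A > 1" and R: "R \<ge> 1" and h: "h > 0"
  shows "\<exists>n. t \<le> (\<Sum>k<n. h * (A ^ k * R)\<^sup>2 / f (A * (A ^ k * R)))"
proof (rule ccontr)
  assume contr: "\<nexists>n. t \<le> (\<Sum>k<n. h * (A ^ k * R)\<^sup>2 / f (A * (A ^ k * R)))"
  define a where "a = (\<lambda>k. h * (A ^ k * R)\<^sup>2 / f (A * (A ^ k * R)))"
  define \<rho> where "\<rho> = (\<lambda>k. A ^ k * R)"
  have \<rho>_pos: "\<rho> k > 0" for k using A R by (simp add: \<rho>_def)
  have \<rho>_Suc: "\<rho> (Suc k) = A * \<rho> k" for k by (simp add: \<rho>_def)
  have a0: "0 \<le> a k" for k
    using f_pos[of "A * \<rho> k"] A h \<rho>_pos[of k] by (simp add: a_def \<rho>_def)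
  have "(\<Sum>k<n. a k) \<le> t" for n using contr unfolding a_def by (meson linear)
  then have sm: "summable a" using a0 by (intro summableI_nonneg_bounded)
  define q where "q = (\<lambda>k. \<rho> (Suc (Suc k)) / f (\<rho> (Suc k)))"
  have q0: "0 \<le> q k" for k
    using f_pos[OF \<rho>_pos] \<rho>_pos by (simp add: q_def less_imp_le)
  have R\<rho>: "1 \<le> \<rho> 1" using A R by (simp add: \<rho>_def less_1_mult' mult_ge1_I)
  let ?first = "\<lambda>r. ennreal (\<rho> 1 / f 1) * indicator {1..<\<rho> 1} r"
  let ?g = "\<lambda>k r. ennreal (q k) * indicator {\<rho> (Suc k)..<\<rho> (Suc (Suc k))} r"
  have term_le_suminf: "s k \<le> (\<Sum>k. s k)" for s :: "nat \<Rightarrow> ennreal" and k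
    using sum_le_suminf[of s "{k}"] by (simp add: summableI)
  have pw: "ennreal (r / f r) * indicator {1..} r \<le> ?first r + (\<Sum>k. ?g k r)" for r
  proof (cases "r \<ge> 1")
    case True
    have quot: "r / f r \<le> v / f w" if "r \<le> v" "w \<le> r" "0 < w" for v w
      using that f_pos[of w] True mono_onD[OF f_mono, of w r] by (intro frac_le) auto
    show ?thesis
    proof (cases "r < \<rho> 1")
      case True
      then have "ennreal (r / f r) \<le> ?first r"
        using quot[of "\<rho> 1" 1] \<open>r \<ge> 1\<close> by (simp add: ennreal_leI)
      then show ?thesis using \<open>r \<ge> 1\<close> by (simp add: add_increasing2)
    next
      case False
      obtain N where "r < A ^ N" using real_arch_pow[OF A] by blast
      also have "A ^ N \<le> \<rho> N" using A R by (simp add: \<rho>_def)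
      finally have ex: "r < \<rho> N" .
      define n where "n = (LEAST n. r < \<rho> n)"
      have n: "r < \<rho> n" unfolding n_def by (rule LeastI[of "\<lambda>n. r < \<rho> n", OF ex])
      have "\<rho> 0 \<le> r" using False A R by (simp add: \<rho>_def) (smt (verit) mult_le_cancel_right1)
      then obtain n1 where n1: "n = Suc n1" using n by (cases n) auto
      have le: "\<rho> n1 \<le> r" using not_less_Least[of n1 "\<lambda>n. r < \<rho> n"] n1 unfolding n_def by auto
      then obtain k where k: "n1 = Suc k" using n n1 False by (cases n1) auto
      have mem: "r \<in> {\<rho> (Suc k)..<\<rho> (Suc (Suc k))}" using le n n1 k by simp
      then have "ennreal (r / f r) \<le> ?g k r"
        using quot[of "\<rho> (Suc (Suc k))" "\<rho> (Suc k)"] \<rho>_pos by (simp add: q_def ennreal_leI)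
      also have "\<dots> \<le> (\<Sum>k. ?g k r)"
        by (rule term_le_suminf)
      finally show ?thesis using \<open>r \<ge> 1\<close> by (simp add: add_increasing)
    qed
  qed simp
  have first_fin: "(\<integral>\<^sup>+r. ?first r \<partial>lborel) < \<infinity>"
    using R\<rho> by (simp add: nn_integral_cmult_indicator ennreal_mult_less_top)
  have "(\<Sum>k. \<integral>\<^sup>+r. ?g k r \<partial>lborel) \<le> (\<Sum>k. ennreal (A ^ 4 / h * a k))"
  proof (intro suminf_le summableI)
    fix k
    have le: "\<rho> (Suc k) \<le> \<rho> (Suc (Suc k))" using A \<rho>_pos[of "Suc k"] unfolding \<rho>_Suc[of "Suc k"] by simp
    have "(\<integral>\<^sup>+r. ?g k r \<partial>lborel) = ennreal (q k * (\<rho> (Suc (Suc k)) - \<rho> (Suc k)))"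
      using le q0 by (simp add: nn_integral_cmult_indicator ennreal_mult)
    also have "\<dots> \<le> ennreal (q k * \<rho> (Suc (Suc k)))"
      using \<rho>_pos[of "Suc k"] q0 by (intro ennreal_leI mult_left_mono) auto
    also have "q k * \<rho> (Suc (Suc k)) = A ^ 4 / h * a k"
    proof -
      have "q k * \<rho> (Suc (Suc k)) = (A * (A * \<rho> k)) * (A * (A * \<rho> k)) / f (A * \<rho> k)"
        by (simp add: q_def \<rho>_Suc)
      also have "\<dots> = A ^ 4 / h * (h * (\<rho> k)\<^sup>2 / f (A * \<rho> k))"
        using h by (simp add: power2_eq_square power4_eq_xxxx mult_ac)
      finally show ?thesis by (simp add: a_def \<rho>_def)
    qed
    finally show "(\<integral>\<^sup>+r. ?g k r \<partial>lborel) \<le> ennreal (A ^ 4 / h * a k)" .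
  qed
  also have "\<dots> < \<infinity>"
  proof -
    have "(\<Sum>k. ennreal (A ^ 4 / h * a k)) \<noteq> top"
      using sm a0 h A by (intro ennreal_suminf_neq_top summable_mult mult_nonneg_nonneg) auto
    then show ?thesis by (simp add: less_top)
  qed
  finally have rest_fin: "(\<Sum>k. \<integral>\<^sup>+r. ?g k r \<partial>lborel) < \<infinity>" .
  have "(\<integral>\<^sup>+r\<in>{1..}. ennreal (r / f r) \<partial>lborel) \<le> (\<integral>\<^sup>+r. ?first r + (\<Sum>k. ?g k r) \<partial>lborel)"
    by (intro nn_integral_mono pw)
  also have "\<dots> = (\<integral>\<^sup>+r. ?first r \<partial>lborel) + (\<Sum>k. \<integral>\<^sup>+r. ?g k r \<partial>lborel)"
    by (subst nn_integral_add) (auto simp: nn_integral_suminf)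
  also have "\<dots> < \<infinity>" using first_fin rest_fin by simp
  finally show False using div by simp
qed


section \<open>Uniqueness\<close>

lemma globally_local_jump_bound:
  assumes "globally_local b d p f"
  obtains S where "S \<ge> 0" "\<And>x y. b x y > 0 \<Longrightarrow> d x y \<le> S"
proof
  have fin: "jump_size b d < top" using assms by (simp add: globally_local_def)
  show "0 \<le> enn2real (jump_size b d)" by simp
  fix x y assume "b x y > 0"
  then have "ennreal (d x y) \<le> jump_size b d"
    unfolding jump_size_def by (intro Sup_upper) blast
  also have "\<dots> = ennreal (enn2real (jump_size b d))" using fin by simp
  finally show "d x y \<le> enn2real (jump_size b d)" by (subst (asm) ennreal_le_iff) auto
qed

lemma globally_local_decay:
  assumes "globally_local b d p f" "pseudo_metric d" "\<And>r. r > 0 \<Longrightarrow> f r > 0"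
  obtains A C r0 where "A > 1" "C > 0"
    "\<And>r x y. r \<ge> r0 \<Longrightarrow> b x y > 0 \<Longrightarrow> r \<le> d p x \<Longrightarrow> r \<le> d p y \<Longrightarrow> d x y * f (A * r) \<le> C * r"
proof -
  obtain A where A: "A > 1" and lim: "Limsup at_top
      (\<lambda>r::real. jump_size_outside b d p r * ennreal (f (A * r)) / ennreal r) < \<infinity>" (is "?L < _")
    using assms(1) unfolding globally_local_def by blast
  obtain c where c: "c \<ge> 0" "?L = ennreal c" using lim by (cases ?L) auto
  have "?L < ennreal (c + 1)" using c by (simp add: ennreal_lessI)
  from Limsup_lessD[OF this] obtain r1 where r1:
    "\<And>r. r \<ge> r1 \<Longrightarrow> jump_size_outside b d p r * ennreal (f (A * r)) / ennreal r < ennreal (c + 1)"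
    unfolding eventually_at_top_linorder by blast
  show thesis
  proof (rule that[of A "c + 1" "max 1 r1"])
    show "A > 1" by (rule A)
    show "c + 1 > 0" using c by simp
    fix r x y assume r: "r \<ge> max 1 r1" and xy: "b x y > 0" "r \<le> d p x" "r \<le> d p y"
    have d: "d x y \<ge> 0" "d p x = d x p" "d p y = d y p"
      using assms(2) unfolding pseudo_metric_def by blast+
    have f: "f (A * r) > 0" using assms(3) r A by simp
    have "ennreal (d x y) \<le> jump_size_outside b d p r"
      unfolding jump_size_outside_def using xy d(2,3) by (intro Sup_upper) auto
    then have "ennreal (d x y) * ennreal (f (A * r)) / ennreal r
        \<le> jump_size_outside b d p r * ennreal (f (A * r)) / ennreal r"
      by (intro divide_right_mono_ennreal mult_right_mono) auto
    also have "\<dots> < ennreal (c + 1)" using r1 r by simp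
    also have "ennreal (d x y) * ennreal (f (A * r)) / ennreal r = ennreal (d x y * f (A * r)) / ennreal r"
      using d f by (simp add: ennreal_mult)
    also have "\<dots> = ennreal (d x y * f (A * r) / r)"
      using d f r by (intro divide_ennreal) auto
    finally have "ennreal (d x y * f (A * r) / r) < ennreal (c + 1)" .
    then have "d x y * f (A * r) / r < c + 1"
      using d f r by (subst (asm) ennreal_less_iff) auto
    then show "d x y * f (A * r) \<le> (c + 1) * r" using r by (simp add: field_simps)
  qed
qed

text \<open>The radius \<open>R\<close> is large enough for all steps as soon as it is beyond \<open>R0\<close>. For such \<open>R\<close> the
  iteration is run down to a positive time \<open>s\<close>, in a number of steps that does not depend on
  \<open>s\<close>. This makes the limit \<open>s \<rightarrow> 0\<close> harmless, as the final ball is fixed and finite.\<close>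

theorem theorem1p3:
  fixes m :: "'a::countable \<Rightarrow> real"
    and b d :: "'a \<Rightarrow> 'a \<Rightarrow> real"
    and p :: 'a
    and f :: "real \<Rightarrow> real"
    and T :: ereal
    and u :: "real \<Rightarrow> 'a \<Rightarrow> real"
  assumes "weighted_graph m b"
    and "intrinsic m b d"
    and "\<And>r. r \<ge> 0 \<Longrightarrow> finite (dist_ball d p r)"
    and "\<And>r. r > 0 \<Longrightarrow> f r > 0"
    and "mono_on {0<..} f"
    and "globally_local b d p f"
    and "(\<integral>\<^sup>+r\<in>{1..}. ennreal (r / f r) \<partial>lborel) = \<infinity>"
    and "0 < T"
    and "heat_solution m b T (\<lambda>x. 0) u"
    and "\<And>r. r > 0 \<Longrightarrow>
      (\<integral>\<^sup>+t\<in>time_interval T. ennreal (\<Sum>x\<in>dist_ball d p r. \<bar>u t x\<bar>\<^sup>2 * m x) \<partial>lborel)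
        \<le> ennreal (exp (f r))"
  shows "\<forall>t\<in>time_interval T. \<forall>x. u t x = 0"
proof (intro ballI allI)
  fix t0 x assume t0: "t0 \<in> time_interval T"
  have "pseudo_metric d" using assms(2) by (simp add: intrinsic_def)
  from globally_local_decay[OF assms(6) this assms(4)]
  obtain A C r0 where A: "A > 1" and C: "C > 0" and decay:
    "\<And>r x y. r \<ge> r0 \<Longrightarrow> b x y > 0 \<Longrightarrow> r \<le> d p x \<Longrightarrow> r \<le> d p y \<Longrightarrow> d x y * f (A * r) \<le> C * r"
    by blast
  from globally_local_jump_bound[OF assms(6)]
  obtain S where S: "S \<ge> 0" "\<And>x y. b x y > 0 \<Longrightarrow> d x y \<le> S"
    by blast
  interpret heat_on_graph m b d p S T u
    by unfold_locales (use assms S in auto)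
  define g where "g = gap A"
  define h where "h = step_const A C"
  define \<Phi> where "\<Phi> = (\<lambda>r t. exp (- (damping A C * t)) * ball_energy r t)"
  define \<delta> where "\<delta> = (\<lambda>R. h * R\<^sup>2 / f (A * R))"
  define R0 where "R0 = Max {1, r0, 3 * S / g}"
  define D where "D = 2 / g\<^sup>2"
  have g: "g > 0" using A by (simp add: g_def gap_def)
  have h: "h > 0" using g by (simp add: h_def g_def step_const_def gauss_const_def)
  have K0: "damping A C \<ge> 0" by (simp add: damping_def)
  have R0: "1 \<le> R0" "r0 \<le> R0" "3 * S / g \<le> R0" by (auto simp: R0_def)
  have f_pos: "f (A * R) > 0" if "R0 \<le> R" for R using that R0 A assms(4) by simp
  have t0_pos: "t0 > 0" using t0 by (simp add: time_interval_def)
  have step: "\<Phi> R t \<le> \<Phi> (A * R) s + D / R\<^sup>2"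
    if "R0 \<le> R" "0 < s" "s \<le> t" "t \<le> t0" "t - s \<le> \<delta> R" for R s t
  proof -
    have t: "t \<in> time_interval T"
      using that by (intro time_interval_mono[OF t0]) auto
    have "3 * S / g \<le> R" using that R0 by simp
    then have "3 * S \<le> gap A * R" using g by (simp add: g_def field_simps)
    then have aw: "annulus_weight A C R S (f (A * R))"
      using A C S R0 f_pos[OF that(1)] that(1) by unfold_locales auto
    have "\<Phi> R t \<le> \<Phi> (A * R) s + 2 / (gap A * R)\<^sup>2"
      unfolding \<Phi>_def
    proof (rule energy_step[OF aw _ that(2,3) t])
      show "d x y * f (A * R) \<le> C * R" if "b x y > 0" "R \<le> d p x" "R \<le> d p y" for x y
        using decay[of R x y] that R0 \<open>R0 \<le> R\<close> by simp
      show "t - s \<le> step_const A C * R\<^sup>2 / f (A * R)" using that by (simp add: \<delta>_def h_def)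
      show "(\<integral>\<^sup>+t\<in>time_interval T. ennreal (ball_energy (A * R) t) \<partial>lborel) \<le> ennreal (exp (f (A * R)))"
        unfolding ball_energy_def using assms(10)[of "A * R"] A R0 that by simp
    qed
    then show ?thesis by (simp add: D_def g_def power_mult_distrib)
  qed
  define G where "G = 1 / (1 - 1 / A\<^sup>2)"
  have A2: "1 / A\<^sup>2 < 1" using A by (simp add: one_less_power)
  have small: "\<Phi> R t0 \<le> D * G / R\<^sup>2" if R: "R0 \<le> R" for R
  proof -
    obtain n where n: "t0 \<le> (\<Sum>k<n. \<delta> (A ^ k * R))"
      using scales_diverge[OF assms(4,5,7) A _ h, of R t0] R R0 unfolding \<delta>_def by auto
    have geo: "(\<Sum>k<n. (1 / A\<^sup>2) ^ k) \<le> G"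
    proof -
      have "(\<Sum>k<n. (1 / A\<^sup>2) ^ k) \<le> (\<Sum>k. (1 / A\<^sup>2) ^ k)"
        using A2 by (intro sum_le_suminf summable_geometric) auto
      also have "\<dots> = G" unfolding G_def using A2 by (intro suminf_geometric) auto
      finally show ?thesis .
    qed
    have bound: "\<Phi> R t0 \<le> ball_energy (A ^ n * R) s + D * G / R\<^sup>2" if s: "0 < s" "s \<le> t0" for s
    proof -
      have "\<Phi> R t0 \<le> \<Phi> (A ^ n * R) s + D / R\<^sup>2 * (\<Sum>k<n. (1 / A\<^sup>2) ^ k)"
        using R R0 A s n h f_pos
        by (intro iterate_scales[where \<Phi> = \<Phi> and \<delta> = \<delta> and ?R0.0 = R0 and ?t0.0 = t0] step)
          (auto simp: \<delta>_def less_imp_le)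
      also have "D / R\<^sup>2 * (\<Sum>k<n. (1 / A\<^sup>2) ^ k) \<le> D / R\<^sup>2 * G"
        using geo by (intro mult_left_mono) (auto simp: D_def)
      also have "\<Phi> (A ^ n * R) s \<le> 1 * ball_energy (A ^ n * R) s"
        unfolding \<Phi>_def using K0 s m_pos
        by (intro mult_right_mono) (auto simp: ball_energy_def less_imp_le intro!: sum_nonneg)
      finally show ?thesis by simp
    qed
    have "((\<lambda>s. ball_energy (A ^ n * R) s + D * G / R\<^sup>2) \<longlongrightarrow> 0 + D * G / R\<^sup>2) (at_right 0)"
      by (intro tendsto_intros ball_energy_initial)
    moreover have "\<forall>\<^sub>F s in at_right 0. \<Phi> R t0 \<le> ball_energy (A ^ n * R) s + D * G / R\<^sup>2"
      using t0_pos bound by (auto simp: eventually_at_right intro!: exI[of _ t0])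
    ultimately have "\<Phi> R t0 \<le> 0 + D * G / R\<^sup>2"
      by (rule tendsto_lowerbound) simp
    then show ?thesis by simp
  qed
  have "exp (- (damping A C * t0)) * ((u t0 x)\<^sup>2 * m x) \<le> 0"
  proof (rule tendsto_lowerbound)
    show "((\<lambda>R. D * G / R\<^sup>2) \<longlongrightarrow> 0) at_top"
      by (intro tendsto_divide_0[OF tendsto_const] filterlim_at_top_imp_at_infinity
          filterlim_pow_at_top filterlim_ident) auto
    show "\<forall>\<^sub>F R in at_top. exp (- (damping A C * t0)) * ((u t0 x)\<^sup>2 * m x) \<le> D * G / R\<^sup>2"
    proof (rule eventually_at_top_linorderI)
      fix R assume R: "max R0 (d p x) \<le> R"
      have "(u t0 x)\<^sup>2 * m x \<le> ball_energy R t0"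
      proof -
        have "x \<in> dist_ball d p R" "finite (dist_ball d p R)"
          using R R0 balls by (auto simp: dist_ball_def)
        from member_le_sum[OF this(1) _ this(2), of "\<lambda>x. \<bar>u t0 x\<bar>\<^sup>2 * m x"]
        show ?thesis using m_pos by (simp add: ball_energy_def less_imp_le)
      qed
      then have "exp (- (damping A C * t0)) * ((u t0 x)\<^sup>2 * m x) \<le> \<Phi> R t0"
        unfolding \<Phi>_def by (intro mult_left_mono) auto
      also have "\<dots> \<le> D * G / R\<^sup>2" using small R by simp
      finally show "exp (- (damping A C * t0)) * ((u t0 x)\<^sup>2 * m x) \<le> D * G / R\<^sup>2" .
    qed
  qed simp
  then have "(u t0 x)\<^sup>2 \<le> 0" using m_pos[of x] by (simp add: mult_le_0_iff)
  then show "u t0 x = 0" by simp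
qed

end
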